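(* Let $q$ be a prime power and $d\geq0$ an integer. If $d<q-1$, then \[ \mathcal{P}(q,d)\leq\sum_{k=1}^{d+1}\left(\frac{1}{k}\right)+\frac{q}{d+2}. \] If $d\geq q-1$, then \[ \mathcal{P}(q,d)\leq\sum_{k=1}^{q}\left(\frac{1}{k}\right). \]
   Context: For $f\in\mathbb{F}_q[x]$, the functional graph $\Gamma_f$ is the directed graph with vertex set $\mathbb{F}_q$ and an edge $\alpha\to\beta$ if and only if $f(\alpha)=\beta$. A $k$-cycle in $\Gamma_f$ is an orbit $\alpha_1\to\alpha_2\to\cdots\to\alpha_k\to\alpha_1$ under $f$ with $\alpha_1,\ldots,\alpha_k\in\mathbb{F}_q$ distinct (taken up to cyclic rotation); a cycle is a $k$-cycle for some $k\geq1$. The cycles of $\Gamma_f$ are in bijection with its connected components (connected components of the underlying undirected graph). $\mathcal{P}(q,d)$ denotes the average number of cycles: \[ \mathcal{P}(q,d)=\frac{\sum_{f\in\mathbb{F}_q[x],\,\deg f=d}\left|\{\text{cycles in }\Gamma_f\}\right|}{\left|\{f\in\mathbb{F}_q[x]:\deg f=d\}\right|}. \] *)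

theory Defs
  imports
    "HOL-Computational_Algebra.Polynomial"
    "HOL-Library.Cardinality"
    "HOL-Number_Theory.Prime_Powers"
    "Graph_Theory.Graph_Theory"
begin

text \<open>The field with \<open>q\<close> elements is a type of class \<open>{field, finite}\<close> with \<open>q = CARD('a)\<close>.\<close>

definition functional_graph :: "'a::{field,finite} poly \<Rightarrow> 'a pair_pre_digraph" where
  "functional_graph f = \<lparr>pverts = UNIV, parcs = {(\<alpha>, \<beta>). poly f \<alpha> = \<beta>}\<rparr>"

text \<open>
  A cycle before passing to the quotient by rotation, i.e. with a marked starting vertex: the list
  of its vertices in the order in which they are visited. Fixed points are cycles of length 1.
\<close>

definition is_k_cycle :: "'a pair_pre_digraph \<Rightarrow> nat \<Rightarrow> 'a list \<Rightarrow> bool" where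
  "is_k_cycle G k xs \<longleftrightarrow> k \<ge> 1 \<and> length xs = k \<and> set xs \<subseteq> pverts G \<and> distinct xs \<and>
     (\<forall>i<k. (xs ! i, xs ! (Suc i mod k)) \<in> parcs G)"

definition rotation_rel :: "'a list rel" where
  "rotation_rel = {(xs, ys). \<exists>n. ys = rotate n xs}"

lemma equiv_rotation_rel: "equiv UNIV (rotation_rel :: 'a list rel)"
proof (rule equivI)
  show "refl (rotation_rel :: 'a list rel)"
    by (auto simp: refl_on_def rotation_rel_def intro: exI[of _ 0])
  show "sym (rotation_rel :: 'a list rel)"
  proof (rule symI)
    fix xs ys :: "'a list"
    assume "(xs, ys) \<in> rotation_rel"
    then obtain n where n: "ys = rotate n xs"
      by (auto simp: rotation_rel_def)
    have "rotate (length xs - n mod length xs) ys = xs" if "xs \<noteq> []"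
    proof -
      have "ys = rotate (n mod length xs) xs"
        using n by (simp add: rotate_conv_mod[symmetric])
      then show ?thesis
        using that by (simp add: rotate_rotate less_imp_le)
    qed
    then show "(ys, xs) \<in> rotation_rel"
      using n unfolding rotation_rel_def by (cases "xs = []") (simp, metis (mono_tags, lifting) case_prodI mem_Collect_eq)
  qed
  show "trans (rotation_rel :: 'a list rel)"
    by (auto simp: trans_def rotation_rel_def rotate_rotate)
qed auto

definition cycles :: "'a pair_pre_digraph \<Rightarrow> 'a list set set" where
  "cycles G = {xs. \<exists>k\<ge>1. is_k_cycle G k xs} // rotation_rel"

text \<open>
  The zero polynomial is excluded explicitly because the library sets \<open>degree 0 = 0\<close>, whereas it
  should not count as a polynomial of degree 0.
\<close>

definition polys_of_degree :: "nat \<Rightarrow> 'a::{field,finite} poly set" where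
  "polys_of_degree d = {f. f \<noteq> 0 \<and> degree f = d}"

definition avg_cycles :: "'a::{field,finite} itself \<Rightarrow> nat \<Rightarrow> real" where
  "avg_cycles _ d =
     (\<Sum>f\<in>(polys_of_degree d :: 'a poly set). real (card (cycles (functional_graph f)))) /
     real (card (polys_of_degree d :: 'a poly set))"

end

theory Submission
  imports Defs
begin

text \<open>
  A \<open>k\<close>-cycle has exactly \<open>k\<close> markings, so marked cycles may be counted instead. For
  \<open>k \<le> d\<close> a tuple of \<open>k\<close> distinct points is a marked cycle of at most \<open>(q - 1) q^(d - k)\<close> of the
  \<open>(q - 1) q^d\<close> polynomials of degree \<open>d\<close>, because these are determined by their coefficients of
  index at least \<open>k\<close>; as there are at most \<open>q^k\<close> tuples, the average number of marked \<open>k\<close>-cycles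
  is at most 1. For \<open>k = d + 1\<close> interpolation gives at most one polynomial per tuple, and there are
  at most \<open>(q - 1) q^d\<close> tuples if \<open>d \<ge> 1\<close>. The cycles of length at least \<open>d + 2\<close> are disjoint, so
  there are at most \<open>q / (d + 2)\<close> of them.
\<close>

section \<open>Marked cycles and their rotation classes\<close>

abbreviation k_cycles :: "'a::{field,finite} poly \<Rightarrow> nat \<Rightarrow> 'a list set" where
  "k_cycles f k \<equiv> {xs. is_k_cycle (functional_graph f) k xs}"

lemma is_k_cycle_functional_graph:
  "is_k_cycle (functional_graph f) k xs \<longleftrightarrow>
     k \<ge> 1 \<and> length xs = k \<and> distinct xs \<and> (\<forall>i<k. poly f (xs ! i) = xs ! (Suc i mod k))"
  by (auto simp: is_k_cycle_def functional_graph_def)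

lemma finite_k_cycles: "finite (k_cycles f k)"
  by (rule finite_subset[OF _ finite_lists_length_eq[of UNIV k]])
    (auto simp: is_k_cycle_functional_graph)

lemma k_cycle_length_le:
  fixes f :: "'a::{field,finite} poly"
  assumes "is_k_cycle (functional_graph f) k xs"
  shows "k \<le> CARD('a)"
proof -
  have "k = card (set xs)"
    using assms by (auto simp: is_k_cycle_functional_graph distinct_card)
  also have "\<dots> \<le> CARD('a)"
    by (rule card_mono) auto
  finally show ?thesis .
qed

lemma is_k_cycle_rotate:
  assumes "is_k_cycle (functional_graph f) k xs"
  shows "is_k_cycle (functional_graph f) k (rotate n xs)"
proof -
  have k: "k \<ge> 1" "length xs = k" "distinct xs"
    and step: "\<And>i. i < k \<Longrightarrow> poly f (xs ! i) = xs ! (Suc i mod k)"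
    using assms by (auto simp: is_k_cycle_functional_graph)
  \<comment> \<open>Entry \<open>i\<close> of the rotated list is entry \<open>(n + i) mod k\<close>
    of \<open>xs\<close>, so its edge is the edge of \<open>xs\<close> at that index.\<close>
  have "poly f (rotate n xs ! i) = rotate n xs ! (Suc i mod k)" if "i < k" for i
    using that k step[of "(n + i) mod k"] by (simp add: nth_rotate mod_simps)
  then show ?thesis
    using k by (simp add: is_k_cycle_functional_graph)
qed

text \<open>Rotation by \<open>n\<close> depends only on \<open>n mod length xs\<close>, and the
  result starts with the entry of \<open>xs\<close> at that index. As the entries are distinct,
  different residues give different lists.\<close>

lemma card_rotation_class:
  assumes "distinct xs" "xs \<noteq> []"
  shows "card (rotation_rel `` {xs}) = length xs"
proof -
  have "rotation_rel `` {xs} = (\<lambda>n. rotate n xs) ` {..<length xs}"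
  proof
    show "rotation_rel `` {xs} \<subseteq> (\<lambda>n. rotate n xs) ` {..<length xs}"
    proof
      fix ys assume "ys \<in> rotation_rel `` {xs}"
      then obtain n where "ys = rotate n xs"
        by (auto simp: rotation_rel_def)
      then have "ys = rotate (n mod length xs) xs"
        by (simp add: rotate_conv_mod[symmetric])
      then show "ys \<in> (\<lambda>n. rotate n xs) ` {..<length xs}"
        using assms by auto
    qed
  qed (auto simp: rotation_rel_def)
  moreover have "inj_on (\<lambda>n. rotate n xs) {..<length xs}"
  proof (rule inj_onI)
    fix m n assume mn: "m \<in> {..<length xs}" "n \<in> {..<length xs}" "rotate m xs = rotate n xs"
    then have "rotate m xs ! 0 = rotate n xs ! 0"
      by simp
    then have "xs ! m = xs ! n"
      using mn(1,2) assms(2) nth_rotate[of 0 xs m] nth_rotate[of 0 xs n] by simp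
    with mn(1,2) assms(1) show "m = n"
      by (simp add: nth_eq_iff_index_eq)
  qed
  ultimately show ?thesis
    by (simp add: card_image)
qed

text \<open>The rotation classes partition the marked \<open>k\<close>-cycles into blocks of size
  \<open>k\<close>.\<close>

lemma card_k_cycles: "k * card (k_cycles f k // rotation_rel) = card (k_cycles f k)"
proof -
  let ?C = "k_cycles f k // rotation_rel"
  \<comment> \<open>\<open>rotation_rel\<close> relates arbitrary lists; closure under rotation
    keeps each class inside the set of marked \<open>k\<close>-cycles.\<close>
  have sub: "rotation_rel `` {xs} \<subseteq> k_cycles f k" if "xs \<in> k_cycles f k" for xs
    using that is_k_cycle_rotate by (auto simp: rotation_rel_def)
  have un: "\<Union>?C = k_cycles f k"
    using sub equiv_class_self[OF equiv_rotation_rel UNIV_I]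
    by (auto simp: quotient_def)
  have "k * card ?C = card (\<Union>?C)"
  proof (rule card_partition)
    show "finite ?C"
      by (simp add: quotient_def finite_k_cycles)
    show "finite (\<Union>?C)"
      unfolding un by (rule finite_k_cycles)
    show "card c = k" if "c \<in> ?C" for c
    proof -
      from that obtain xs where "xs \<in> k_cycles f k" "c = rotation_rel `` {xs}"
        by (auto simp: quotient_def)
      then show ?thesis
        using card_rotation_class[of xs] by (cases "xs = []") (auto simp: is_k_cycle_functional_graph)
    qed
    show "c \<inter> d = {}" if "c \<in> ?C" "d \<in> ?C" "c \<noteq> d" for c d
      using quotient_disj[OF equiv_rotation_rel, of c d] that by (auto simp: quotient_def)
  qed
  with un show ?thesis
    by simp
qed

text \<open>This division by \<open>k\<close> is the origin of the harmonic sum in the final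
  bounds.\<close>

lemma card_k_cycle_classes:
  "k \<ge> 1 \<Longrightarrow> real (card (k_cycles f k // rotation_rel)) = real (card (k_cycles f k)) / real k"
  by (simp add: card_k_cycles[of k f, symmetric])

lemma card_cycles_le:
  fixes f :: "'a::{field,finite} poly"
  shows "card (cycles (functional_graph f)) \<le> (\<Sum>k=1..CARD('a). card (k_cycles f k // rotation_rel))"
proof -
  have "cycles (functional_graph f) = (\<Union>k\<in>{1..CARD('a)}. k_cycles f k // rotation_rel)"
    using k_cycle_length_le[of f] by (fastforce simp: cycles_def quotient_def)
  then show ?thesis
    by (simp add: card_UN_le)
qed

section \<open>Disjointness of cycles and the bound for long cycles\<close>

lemma k_cycle_nth:
  assumes "is_k_cycle (functional_graph f) k xs" "i < k"
  shows "xs ! i = (poly f ^^ i) (hd xs)"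
  using assms(2)
proof (induction i)
  case 0
  with assms show ?case
    by (cases xs) (auto simp: is_k_cycle_functional_graph)
next
  case (Suc i)
  from Suc.prems have "poly f (xs ! i) = xs ! (Suc i mod k)"
    using assms(1) by (simp add: is_k_cycle_functional_graph)
  with Suc show ?case
    by simp
qed

lemma k_cycle_return:
  assumes "is_k_cycle (functional_graph f) k xs"
  shows "(poly f ^^ k) (hd xs) = hd xs"
proof -
  \<comment> \<open>At the last index \<open>k - 1\<close> the modulus wraps around to 0: this is
    the edge that closes the cycle.\<close>
  have k: "k \<ge> 1" "length xs = k" "poly f (xs ! (k - 1)) = xs ! (Suc (k - 1) mod k)"
    using assms by (auto simp: is_k_cycle_functional_graph)
  then have "poly f (xs ! (k - 1)) = hd xs"
    by (cases xs) auto
  moreover have "xs ! (k - 1) = (poly f ^^ (k - 1)) (hd xs)"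
    using k by (intro k_cycle_nth[OF assms]) auto
  ultimately have "(poly f ^^ Suc (k - 1)) (hd xs) = hd xs"
    by simp
  with k show ?thesis
    by simp
qed

text \<open>The orbit of the common start returns after \<open>k\<close> steps. If \<open>l\<close>
  exceeded \<open>k\<close>, then \<open>ys\<close> would repeat its first entry at index
  \<open>k\<close>, against distinctness. Equality of the lengths follows by symmetry.\<close>

lemma k_cycle_length_unique:
  assumes xs: "is_k_cycle (functional_graph f) k xs" and ys: "is_k_cycle (functional_graph f) l ys"
    and hd: "hd xs = hd ys"
  shows "l \<le> k"
proof (rule ccontr)
  assume "\<not> l \<le> k"
  then have "ys ! k = (poly f ^^ k) (hd ys)" "ys ! 0 = hd ys"
    using k_cycle_nth[OF ys, of k] k_cycle_nth[OF ys, of 0] by auto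
  then have "ys ! k = ys ! 0"
    using k_cycle_return[OF xs] hd by simp
  with \<open>\<not> l \<le> k\<close> xs ys show False
    by (auto simp: is_k_cycle_functional_graph nth_eq_iff_index_eq)
qed

text \<open>Disjointness of cycles in terms of markings: a vertex starts at most one marked cycle,
  since it determines both the length and, by iterating \<open>f\<close>, every entry.\<close>

lemma inj_on_hd_k_cycles: "inj_on hd (\<Union>k. k_cycles f k)"
proof (rule inj_onI)
  fix xs ys assume "xs \<in> (\<Union>k. k_cycles f k)" "ys \<in> (\<Union>k. k_cycles f k)" and hd: "hd xs = hd ys"
  then obtain k l where kl: "is_k_cycle (functional_graph f) k xs" "is_k_cycle (functional_graph f) l ys"
    by auto
  with hd have "k = l"
    by (metis k_cycle_length_unique le_antisym)
  show "xs = ys"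
  proof (rule nth_equalityI)
    show "length xs = length ys"
      using kl \<open>k = l\<close> by (auto simp: is_k_cycle_functional_graph)
    show "xs ! i = ys ! i" if "i < length xs" for i
      using that kl \<open>k = l\<close> hd k_cycle_nth[OF kl(1), of i] k_cycle_nth[OF kl(2), of i]
      by (auto simp: is_k_cycle_functional_graph)
  qed
qed

text \<open>Each cycle of length at least \<open>m\<close> accounts for at least \<open>m\<close>
  marked cycles, and by injectivity of \<open>hd\<close> there are no more marked cycles than
  vertices.\<close>

lemma card_long_cycles_le:
  fixes f :: "'a::{field,finite} poly"
  assumes "m \<ge> 1"
  shows "real (\<Sum>k=m..n. card (k_cycles f k // rotation_rel)) \<le> real CARD('a) / real m"
proof -
  let ?L = "\<Union>k\<in>{m..n}. k_cycles f k"
  have "m * (\<Sum>k=m..n. card (k_cycles f k // rotation_rel)) \<le>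
      (\<Sum>k=m..n. k * card (k_cycles f k // rotation_rel))"
    unfolding sum_distrib_left by (rule sum_mono) auto
  also have "\<dots> = (\<Sum>k=m..n. card (k_cycles f k))"
    by (simp add: card_k_cycles)
  also have "\<dots> = card ?L"
    by (rule card_UN_disjoint[symmetric])
      (auto simp: finite_k_cycles, auto simp: is_k_cycle_functional_graph)
  also have "\<dots> \<le> CARD('a)"
    by (rule card_inj_on_le[of hd]) (auto intro: inj_on_subset[OF inj_on_hd_k_cycles])
  finally have "real m * real (\<Sum>k=m..n. card (k_cycles f k // rotation_rel)) \<le> real CARD('a)"
    by (metis of_nat_le_iff of_nat_mult)
  then show ?thesis
    using assms by (simp add: pos_le_divide_eq mult.commute)
qed

section \<open>Counting polynomials of degree \<open>d\<close> by coefficients and by values\<close>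

lemma card_lists_times_nonzero:
  "card ({xs::'a::{field,finite} list. length xs = n} \<times> (UNIV - {0::'a})) = (CARD('a) - 1) * CARD('a) ^ n"
  using card_lists_length_eq[of "UNIV :: 'a set" n]
  by (simp add: card_cartesian_product card_Diff_subset mult.commute)

lemma finite_polys_of_degree: "finite (polys_of_degree d :: 'a::{field,finite} poly set)"
proof (rule inj_on_finite)
  show "inj_on coeffs (polys_of_degree d :: 'a poly set)"
    by (simp add: inj_on_def coeffs_eq_iff)
  show "coeffs ` polys_of_degree d \<subseteq> {xs :: 'a list. set xs \<subseteq> UNIV \<and> length xs = Suc d}"
    by (auto simp: polys_of_degree_def length_coeffs_degree)
qed (rule finite_lists_length_eq, simp)

text \<open>The \<open>d\<close> lower coefficients are free and the leading one is any nonzero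
  element. The inequality has this direction because the number of polynomials will bound the counts
  of marked cycles from above.\<close>

lemma card_polys_of_degree_ge:
  "(CARD('a) - 1) * CARD('a) ^ d \<le> card (polys_of_degree d :: 'a::{field,finite} poly set)"
proof -
  let ?D = "{xs::'a list. length xs = d} \<times> (UNIV - {0::'a})"
  let ?h = "\<lambda>(xs, a). Poly (xs @ [a])"
  \<comment> \<open>\<open>Poly\<close> strips trailing zeros; the nonzero last entry prevents this,
    so \<open>coeffs\<close> recovers the list.\<close>
  have co: "coeffs (Poly (xs @ [a])) = xs @ [a]" if "a \<noteq> 0" for xs and a :: 'a
    using that by (simp add: strip_while_def)
  have "card ?D \<le> card (polys_of_degree d :: 'a poly set)"
  proof (rule card_inj_on_le[of ?h])
    show "inj_on ?h ?D"
    proof (rule inj_on_inverseI)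
      show "(butlast (coeffs (?h x)), last (coeffs (?h x))) = x" if "x \<in> ?D" for x
        using that
        by (elim SigmaE)
          (simp only: co prod.case Diff_iff singleton_iff butlast_snoc last_snoc simp_thms)
    qed
    show "?h ` ?D \<subseteq> polys_of_degree d"
    proof (rule image_subsetI)
      fix x assume "x \<in> ?D"
      then obtain xs a where x: "x = (xs, a)" "length xs = d" "a \<noteq> 0"
        by auto
      have "?h x \<noteq> 0"
        using co[OF x(3), of xs] unfolding x(1) prod.case
        by (metis append_is_Nil_conv coeffs_0_eq_Nil list.distinct(1))
      moreover have "coeffs (?h x) = xs @ [a]"
        using co[OF x(3)] unfolding x(1) prod.case .
      ultimately show "?h x \<in> polys_of_degree d"
        using x(2) length_coeffs_degree[of "?h x"] unfolding polys_of_degree_def by force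
    qed
  qed (rule finite_polys_of_degree)
  then show ?thesis
    unfolding card_lists_times_nonzero .
qed

text \<open>Otherwise \<open>f - g\<close> would be a nonzero polynomial with at least
  \<open>length xs\<close> roots, although its coefficients vanish from index
  \<open>length xs\<close> on.\<close>

lemma poly_eqI_values_coeffs:
  fixes f g :: "'a::{field,finite} poly"
  assumes "distinct xs" "\<And>x. x \<in> set xs \<Longrightarrow> poly f x = poly g x"
    and "\<And>i. i \<ge> length xs \<Longrightarrow> coeff f i = coeff g i"
  shows "f = g"
proof (rule ccontr)
  assume "f \<noteq> g"
  then have nz: "f - g \<noteq> 0"
    by simp
  have "length xs = card (set xs)"
    using assms(1) by (simp add: distinct_card)
  also have "\<dots> \<le> card {x. poly (f - g) x = 0}"
    using assms(2) by (intro card_mono) auto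
  also have "\<dots> \<le> degree (f - g)"
    using nz by (rule card_poly_roots_bound)
  finally have "lead_coeff (f - g) = 0"
    using assms(3) by simp
  with nz show False
    by (simp only: leading_coeff_0_iff simp_thms)
qed

lemma card_polys_through_le:
  fixes xs :: "'a::{field,finite} list"
  assumes "distinct xs" "length xs \<le> d"
  shows "card {f \<in> polys_of_degree d. \<forall>i<length xs. poly f (xs ! i) = v i}
           \<le> (CARD('a) - 1) * CARD('a) ^ (d - length xs)" (is "card ?F \<le> _")
proof -
  \<comment> \<open>With the values fixed, the coefficients of index at least
    \<open>length xs\<close> determine \<open>f\<close>. The leading one is kept apart because it
    ranges over nonzero elements.\<close>
  let ?h = "\<lambda>f :: 'a poly. (map (coeff f) [length xs..<d], coeff f d)"
  have "card ?F \<le> card ({ys::'a list. length ys = d - length xs} \<times> (UNIV - {0::'a}))"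
  proof (rule card_inj_on_le[of ?h])
    show "inj_on ?h ?F"
    proof (rule inj_onI)
      fix f g assume fg: "f \<in> ?F" "g \<in> ?F" "?h f = ?h g"
      show "f = g"
      proof (rule poly_eqI_values_coeffs[OF assms(1)])
        show "poly f x = poly g x" if "x \<in> set xs" for x
          using fg that by (auto simp: in_set_conv_nth)
        show "coeff f i = coeff g i" if "i \<ge> length xs" for i
        proof (cases "i > d")
          case True
          then show ?thesis
            using fg by (auto simp: polys_of_degree_def coeff_eq_0)
        next
          case False
          then show ?thesis
            using fg that by (cases "i = d") auto
        qed
      qed
    qed
    have "finite {ys::'a list. length ys = d - length xs}"
      using finite_lists_length_eq[of "UNIV :: 'a set"] by simp
    then show "finite ({ys::'a list. length ys = d - length xs} \<times> (UNIV - {0::'a}))"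
      by simp
  qed (auto simp: polys_of_degree_def)
  then show ?thesis
    unfolding card_lists_times_nonzero .
qed

lemma card_polys_through_le_1:
  fixes xs :: "'a::{field,finite} list"
  assumes "distinct xs" "length xs = Suc d"
  shows "card {f \<in> polys_of_degree d. \<forall>i<length xs. poly f (xs ! i) = v i} \<le> 1" (is "card ?F \<le> _")
proof -
  have "f = g" if fg: "f \<in> ?F" "g \<in> ?F" for f g
  proof (rule poly_eqI_values_coeffs[OF assms(1)])
    show "poly f x = poly g x" if "x \<in> set xs" for x
      using fg that by (auto simp: in_set_conv_nth)
    show "coeff f i = coeff g i" if "i \<ge> length xs" for i
      using fg that assms by (auto simp: polys_of_degree_def coeff_eq_0)
  qed
  then show ?thesis
    by (simp add: card_le_Suc0_iff_eq finite_polys_of_degree)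
qed

text \<open>The count is the falling factorial \<open>q (q - 1) ... (q - k + 1)\<close>. The factor
  \<open>q - 1\<close> is kept and the other \<open>k - 1\<close> factors are bounded by
  \<open>q\<close>; for \<open>k = d + 1\<close> this matches the number \<open>(q - 1) q^d\<close>
  of polynomials.\<close>

lemma card_distinct_lists_le:
  assumes "k \<ge> 2"
  shows "card {xs::'a::finite list. length xs = k \<and> distinct xs} \<le> (CARD('a) - 1) * CARD('a) ^ (k - 1)"
proof (cases "k \<le> CARD('a)")
  case True
  let ?q = "CARD('a)"
  have "card {xs::'a list. length xs = k \<and> distinct xs} = \<Prod>{?q - k + 1..?q}"
    using card_lists_distinct_length_eq[of "UNIV :: 'a set" k] True by simp
  \<comment> \<open>The interval contains \<open>?q - 1\<close> because
    \<open>k \<ge> 2\<close>.\<close>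
  also have "{?q - k + 1..?q} = insert (?q - 1) ({?q - k + 1..?q} - {?q - 1})"
    using assms True by auto
  also have "\<Prod>\<dots> = (?q - 1) * \<Prod>({?q - k + 1..?q} - {?q - 1})"
    by (subst prod.insert_remove) auto
  also have "\<Prod>({?q - k + 1..?q} - {?q - 1}) \<le> (\<Prod>x\<in>{?q - k + 1..?q} - {?q - 1}. ?q)"
    by (rule prod_mono) auto
  also have "\<dots> = ?q ^ (k - 1)"
    using assms True by (simp add: card_Diff_subset)
  finally show ?thesis
    by simp
next
  case False
  have "length xs \<le> CARD('a)" if "distinct xs" for xs :: "'a list"
    using that card_mono[of UNIV "set xs"] by (simp add: distinct_card)
  with False have "{xs::'a list. length xs = k \<and> distinct xs} = {}"
    by auto
  then show ?thesis
    by (simp only: card.empty)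
qed

section \<open>Averaging the number of marked \<open>k\<close>-cycles\<close>

lemma sum_card_k_cycles_le_mult:
  assumes "\<And>xs :: 'a::{field,finite} list. distinct xs \<Longrightarrow> length xs = k \<Longrightarrow>
    card {f \<in> polys_of_degree d. \<forall>i<length xs. poly f (xs ! i) = xs ! (Suc i mod k)} \<le> b"
  shows "(\<Sum>f\<in>(polys_of_degree d :: 'a poly set). card (k_cycles f k))
    \<le> card {xs::'a list. length xs = k \<and> distinct xs} * b"
proof -
  let ?P = "polys_of_degree d :: 'a poly set"
  let ?T = "{xs::'a list. length xs = k \<and> distinct xs}"
  let ?R = "\<lambda>f (xs::'a list). is_k_cycle (functional_graph f) k xs"
  have finT: "finite ?T"
    by (rule finite_subset[OF _ finite_lists_length_eq[of UNIV k]]) auto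
  have "k_cycles f k = {xs \<in> ?T. ?R f xs}" for f
    by (auto simp: is_k_cycle_functional_graph)
  then have "(\<Sum>f\<in>?P. card (k_cycles f k)) = (\<Sum>f\<in>?P. card {xs \<in> ?T. ?R f xs})"
    by simp
  also have "\<dots> = (\<Sum>f\<in>?P. \<Sum>xs\<in>?T. if ?R f xs then 1 else 0)"
    using finT by (simp add: sum.If_cases Int_def)
  \<comment> \<open>Double counting of the pairs of a polynomial and a marked cycle of it: from here
    on the tuple is fixed and the polynomial varies.\<close>
  also have "\<dots> = (\<Sum>xs\<in>?T. \<Sum>f\<in>?P. if ?R f xs then 1 else 0)"
    by (rule sum.swap)
  also have "\<dots> = (\<Sum>xs\<in>?T. card {f \<in> ?P. ?R f xs})"
    by (simp add: finite_polys_of_degree sum.If_cases Int_def)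
  also have "\<dots> \<le> (\<Sum>xs\<in>?T. b)"
  proof (rule sum_mono)
    fix xs assume xs: "xs \<in> ?T"
    have "card {f \<in> ?P. ?R f xs} \<le>
        card {f \<in> ?P. \<forall>i<length xs. poly f (xs ! i) = xs ! (Suc i mod k)}"
      by (rule card_mono) (auto simp: finite_polys_of_degree is_k_cycle_functional_graph)
    also have "\<dots> \<le> b"
      using xs by (intro assms) auto
    finally show "card {f \<in> ?P. ?R f xs} \<le> b" .
  qed
  finally show ?thesis
    by simp
qed

lemma sum_card_k_cycles_le:
  assumes "1 \<le> k" "k \<le> d + 1"
  shows "(\<Sum>f\<in>(polys_of_degree d :: 'a::{field,finite} poly set). card (k_cycles f k))
    \<le> card (polys_of_degree d :: 'a poly set)" (is "?S \<le> ?N")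
proof -
  let ?q = "CARD('a)"
  consider "k \<le> d" | "k = d + 1" "d \<ge> 1" | "k = 1" "d = 0"
    using assms by linarith
  then show ?thesis
  proof cases
    case 1
    have "?S \<le> card {xs::'a list. length xs = k \<and> distinct xs} * ((?q - 1) * ?q ^ (d - k))"
      by (rule sum_card_k_cycles_le_mult) (use 1 card_polys_through_le in auto)
    also have "card {xs::'a list. length xs = k \<and> distinct xs} \<le> card {xs::'a list. set xs \<subseteq> UNIV \<and> length xs = k}"
      by (rule card_mono) (rule finite_lists_length_eq, auto)
    also have "\<dots> = ?q ^ k"
      by (rule card_lists_length_eq) simp
    \<comment> \<open>The \<open>k\<close> conditions on the values cost exactly the factor
      \<open>?q ^ k\<close> that the choice of the tuple gains.\<close>
    also have "?q ^ k * ((?q - 1) * ?q ^ (d - k)) = (?q - 1) * ?q ^ d"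
      using 1 by (simp add: power_add[symmetric] mult.left_commute)
    also have "\<dots> \<le> ?N"
      by (rule card_polys_of_degree_ge)
    finally show ?thesis
      by simp
  next
    case 2
    have "?S \<le> card {xs::'a list. length xs = k \<and> distinct xs} * 1"
      by (rule sum_card_k_cycles_le_mult, rule card_polys_through_le_1) (use 2 in auto)
    also have "\<dots> \<le> (?q - 1) * ?q ^ d"
      using card_distinct_lists_le[of k, where 'a = 'a] 2 by simp
    also have "\<dots> \<le> ?N"
      by (rule card_polys_of_degree_ge)
    finally show ?thesis .
  next
    case 3
    \<comment> \<open>Interpolation alone gives \<open>q / (q - 1)\<close> here: the fixed point 0 only comes from the zero polynomial.\<close>
    have "card (k_cycles f k) \<le> 1" if f: "f \<in> polys_of_degree d" for f :: "'a poly"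
    proof -
      from f 3 obtain c where "f = [:c:]"
        by (auto simp: polys_of_degree_def elim: degree_eq_zeroE)
      then have "k_cycles f k \<subseteq> {[c]}"
        using 3 by (auto simp: is_k_cycle_functional_graph length_Suc_conv)
      then show ?thesis
        using card_mono[of "{[c]}"] by fastforce
    qed
    then have "?S \<le> (\<Sum>f\<in>(polys_of_degree d :: 'a poly set). 1)"
      by (rule sum_mono)
    then show ?thesis
      by simp
  qed
qed

lemma avg_k_cycles_le:
  assumes "n \<le> d + 1"
  shows "(\<Sum>f\<in>(polys_of_degree d :: 'a::{field,finite} poly set).
             \<Sum>k=1..n. real (card (k_cycles f k // rotation_rel)))
    \<le> real (card (polys_of_degree d :: 'a poly set)) * (\<Sum>k=1..n. 1 / real k)"
proof -
  let ?P = "polys_of_degree d :: 'a poly set"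
  have "(\<Sum>f\<in>?P. \<Sum>k=1..n. real (card (k_cycles f k // rotation_rel)))
      = (\<Sum>k=1..n. \<Sum>f\<in>?P. real (card (k_cycles f k // rotation_rel)))"
    by (rule sum.swap)
  also have "\<dots> = (\<Sum>k=1..n. real (\<Sum>f\<in>?P. card (k_cycles f k)) / real k)"
    by (simp add: card_k_cycle_classes sum_divide_distrib)
  also have "\<dots> \<le> (\<Sum>k=1..n. real (card ?P) / real k)"
    using assms by (intro sum_mono divide_right_mono of_nat_mono sum_card_k_cycles_le) auto
  finally show ?thesis
    by (simp add: sum_distrib_left)
qed

section \<open>From sums over all polynomials to the two bounds on the average\<close>

lemma avg_cycles_leI:
  assumes "(\<Sum>f\<in>(polys_of_degree d :: 'a::{field,finite} poly set). real (card (cycles (functional_graph f))))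
    \<le> real (card (polys_of_degree d :: 'a poly set)) * b"
  shows "avg_cycles TYPE('a) d \<le> b"
proof -
  \<comment> \<open>A witness that the denominator of the average is nonzero.\<close>
  have "monom (1::'a) d \<in> polys_of_degree d"
    by (simp add: polys_of_degree_def degree_monom_eq)
  then have "card (polys_of_degree d :: 'a poly set) > 0"
    by (auto simp: card_gt_0_iff finite_polys_of_degree)
  with assms show ?thesis
    by (simp add: avg_cycles_def pos_divide_le_eq mult.commute)
qed

theorem corollary2p4:
  fixes q d :: nat
  assumes "primepow q"
    and "CARD('a::{field,finite}) = q"
  shows "(d < q - 1 \<longrightarrow>
            avg_cycles TYPE('a) d \<le> (\<Sum>k=1..d+1. 1 / real k) + real q / real (d + 2)) \<and>
         (d \<ge> q - 1 \<longrightarrow>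
            avg_cycles TYPE('a) d \<le> (\<Sum>k=1..q. 1 / real k))"
proof (intro conjI impI)
  let ?P = "polys_of_degree d :: 'a poly set"
  let ?c = "\<lambda>f k. card (k_cycles (f :: 'a poly) k // rotation_rel)"
  have cyc: "real (card (cycles (functional_graph f))) \<le> (\<Sum>k=1..q. real (?c f k))" for f :: "'a poly"
    using card_cycles_le[of f] assms(2) by (metis of_nat_le_iff of_nat_sum)
  {
    assume d: "d < q - 1"
    have "real (card (cycles (functional_graph f)))
        \<le> (\<Sum>k=1..d+1. real (?c f k)) + real q / real (d + 2)" for f :: "'a poly"
    proof -
      \<comment> \<open>Lengths up to \<open>d + 1\<close> are left for averaging over
        \<open>f\<close>; the longer cycles are bounded for each \<open>f\<close>
        separately.\<close>
      have "(\<Sum>k=1..q. real (?c f k)) = (\<Sum>k=1..d+1. real (?c f k)) + real (\<Sum>k=d+2..q. ?c f k)"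
        using sum.ub_add_nat[of 1 "d + 1" "\<lambda>k. real (?c f k)" "q - (d + 1)"] d by simp
      with cyc[of f] card_long_cycles_le[of "d + 2" f q] assms(2) show ?thesis
        by simp
    qed
    then have "(\<Sum>f\<in>?P. real (card (cycles (functional_graph f))))
        \<le> (\<Sum>f\<in>?P. (\<Sum>k=1..d+1. real (?c f k)) + real q / real (d + 2))"
      by (intro sum_mono)
    also have "\<dots> = (\<Sum>f\<in>?P. \<Sum>k=1..d+1. real (?c f k)) + real (card ?P) * (real q / real (d + 2))"
      by (simp add: sum.distrib)
    also have "\<dots> \<le> real (card ?P) * ((\<Sum>k=1..d+1. 1 / real k) + real q / real (d + 2))"
      using avg_k_cycles_le[of "d + 1" d, where 'a = 'a] by (simp add: distrib_left)
    finally show "avg_cycles TYPE('a) d \<le> (\<Sum>k=1..d+1. 1 / real k) + real q / real (d + 2)"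
      by (rule avg_cycles_leI)
  next
    assume "d \<ge> q - 1"
    have "(\<Sum>f\<in>?P. real (card (cycles (functional_graph f)))) \<le> (\<Sum>f\<in>?P. \<Sum>k=1..q. real (?c f k))"
      by (intro sum_mono cyc)
    \<comment> \<open>Here \<open>q \<le> d + 1\<close>, so the averaging estimate covers every
      possible cycle length.\<close>
    also have "\<dots> \<le> real (card ?P) * (\<Sum>k=1..q. 1 / real k)"
      using \<open>d \<ge> q - 1\<close> by (intro avg_k_cycles_le) simp
    finally show "avg_cycles TYPE('a) d \<le> (\<Sum>k=1..q. 1 / real k)"
      by (rule avg_cycles_leI)
  }
qed

end
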